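(* For any given resource semiring $\mathcal{S}$, the model of linear logic in $\mathbf{Rel}$ with exponential $!^{\mathcal{S}}$ described below is a model of promotion-free differential linear logic ($\mathsf{DiLL}_0$), implementing the codereliction $\bar{\mathsf{d}}$, coweakening $\bar{\mathsf{w}}$ and cocontraction $\bar{\mathsf{c}}$ as the inverse relations of the dereliction, weakening and contraction: $$ \bar{\mathsf{d}}_A:= \{(a,b)\mid (b,a)\in \mathsf{d}_A\}\quad \bar{\mathsf{w}}_A:= \{(a,b)\mid (b,a)\in \mathsf{w}_A\}\quad \bar{\mathsf{c}}_A:= \{(a,b)\mid (b,a)\in \mathsf{c}_A\}.$$
   Context: A resource semiring $\mathcal{S}$ is a semiring $(\mathcal{S},0,+,1,\times)$ (with $+$ commutative with unit $0$, $\times$ associative with unit $1$ and distributing over $+$) that is: discrete ($x+y=1$ implies $x=0$ or $y=0$); positive ($x+y=0$ implies $x=0$ or $y=0$); additive splitting (whenever $x_1+x_2=x_3+x_4$ there are $x_{1,3},x_{1,4},x_{2,3},x_{2,4}$ with $x_1=x_{1,3}+x_{1,4}$, $x_2=x_{2,3}+x_{2,4}$, $x_3=x_{1,3}+x_{2,3}$, $x_4=x_{1,4}+x_{2,4}$); and multiplicative splitting (whenever $sr=x+y$ there are $s_1,\dots,s_n,r_1,\dots,r_m$ and $U\subseteq\{1,\dots,n\}\times\{1,\dots,m\}$ with $s=\sum_i s_i$, $r=\sum_j r_j$, $x=\sum_{(i,j)\in U}s_ir_j$, $y=\sum_{(i,j)\notin U}s_ir_j$). The model: $\mathbf{Rel}$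 is the category of sets and relations, symmetric monoidal with $A\otimes B:=A\times B$, $r\otimes r':=\{((a,a'),(b,b'))\mid (a,b)\in r,(a',b')\in r'\}$, and compact closed with $A^\bot:=A$, $r^\bot:=\{(a,b)\mid (b,a)\in r\}$. The exponential is $!^{\mathcal{S}} A:=$ the set of finitely supported functions $f:A\to\mathcal{S}$; for $r\in\mathbf{Rel}(A,B)$, $!^{\mathcal{S}} r:=\{((a\mapsto\sum_b\sigma(a,b)),(b\mapsto\sum_a\sigma(a,b)))\mid \sigma:r\to\mathcal{S}\text{ finitely supported}\}$. Weakening $\mathsf{w}_A:=\{([],* )\}$ with $[]:=(a\mapsto 0)$; contraction $\mathsf{c}_A:=\{((a\mapsto f(a)+g(a)),(f,g))\mid f,g\in !^{\mathcal{S}}A\}$; dereliction $\mathsf{d}_A:=\{(\delta_a,a)\}$ where $\delta_a(a)=1$ and $\delta_a(b)=0$ for $b\neq a$; digging $\mathsf{p}_A:=\{((a\mapsto\sum_f F(f)\cdot f(a)),F)\mid F\in !^{\mathcal{S}}!^{\mathcal{S}}A\}$; monoidality $\mathsf{m}_\bot:=\{( *,f)\mid f\in !^{\mathcal{S}}1\}$ and $\mathsf{m}_{A,B}:=\{((\sum_b\sigma(\_,b),\sum_a\sigma(a,\_)),\sigma)\mid \sigma\in !^{\mathcal{S}}(A\times B)\}$. This is known to be a model of linear logic. *)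

theory Defs
  imports Main "HOL-Library.Poly_Mapping" "HOL-Library.FSet"
begin

section \<open>Resource semirings\<close>

text \<open>The class \<^class>\<open>semiring_1\<close> does not require multiplication to commute; it contains
  0 * x = x * 0 = 0 and 0 \<noteq> 1.\<close>

class resource_semiring = semiring_1 +
  assumes discrete: "x + y = 1 \<Longrightarrow> x = 0 \<or> y = 0"
    and positive: "x + y = 0 \<Longrightarrow> x = 0 \<or> y = 0"
    and additive_splitting: "x1 + x2 = x3 + x4 \<Longrightarrow>
      \<exists>x13 x14 x23 x24. x1 = x13 + x14 \<and> x2 = x23 + x24 \<and> x3 = x13 + x23 \<and> x4 = x14 + x24"
    and multiplicative_splitting: "s * r = x + y \<Longrightarrow>
      \<exists>(n::nat) (m::nat) s' r' U. U \<subseteq> {1..n} \<times> {1..m} \<and>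
        s = (\<Sum>i\<in>{1..n}. s' i) \<and> r = (\<Sum>j\<in>{1..m}. r' j) \<and>
        x = (\<Sum>(i, j)\<in>U. s' i * r' j) \<and>
        y = (\<Sum>(i, j)\<in>({1..n} \<times> {1..m}) - U. s' i * r' j)"


section \<open>Models of promotion-free differential linear logic\<close>

text \<open>The data of a model of linear logic together with a sum of morphisms. The objects are the
  elements of the type \<open>'o\<close>. A morphism need not determine its source and target, so families of
  morphisms are indexed by objects.\<close>

record ('o, 'm) ll_structure =
  hom :: "'o \<Rightarrow> 'o \<Rightarrow> 'm set" ("Hom\<index>")
  ident :: "'o \<Rightarrow> 'm" ("Ident\<index>")
  compose :: "'m \<Rightarrow> 'm \<Rightarrow> 'm" (infixl "\<cdot>\<index>" 70)
  unit_ob :: "'o" ("\<one>\<index>")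
  tensor_ob :: "'o \<Rightarrow> 'o \<Rightarrow> 'o" (infixl "\<otimes>\<index>" 80)
  tensor :: "'m \<Rightarrow> 'm \<Rightarrow> 'm" (infixl "\<odot>\<index>" 75)
  associator :: "'o \<Rightarrow> 'o \<Rightarrow> 'o \<Rightarrow> 'm" ("Assoc\<index>")
  associator_inv :: "'o \<Rightarrow> 'o \<Rightarrow> 'o \<Rightarrow> 'm" ("AssocInv\<index>")
  left_unitor :: "'o \<Rightarrow> 'm" ("Lunit\<index>")
  left_unitor_inv :: "'o \<Rightarrow> 'm" ("LunitInv\<index>")
  right_unitor :: "'o \<Rightarrow> 'm" ("Runit\<index>")
  right_unitor_inv :: "'o \<Rightarrow> 'm" ("RunitInv\<index>")
  symmetry :: "'o \<Rightarrow> 'o \<Rightarrow> 'm" ("Swap\<index>")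
  dual_ob :: "'o \<Rightarrow> 'o"
  dual :: "'m \<Rightarrow> 'm"
  curry_dual :: "'o \<Rightarrow> 'o \<Rightarrow> 'o \<Rightarrow> 'm \<Rightarrow> 'm"
  zero_mor :: "'o \<Rightarrow> 'o \<Rightarrow> 'm"
  add_mor :: "'m \<Rightarrow> 'm \<Rightarrow> 'm" (infixl "\<oplus>\<index>" 65)
  bang_ob :: "'o \<Rightarrow> 'o"
  bang :: "'m \<Rightarrow> 'm"
  weakening :: "'o \<Rightarrow> 'm"
  contraction :: "'o \<Rightarrow> 'm"
  dereliction :: "'o \<Rightarrow> 'm"
  digging :: "'o \<Rightarrow> 'm"
  monoidality_unit :: "'m"
  monoidality :: "'o \<Rightarrow> 'o \<Rightarrow> 'm"

locale category =
  fixes L :: "('o, 'm, 'z) ll_structure_scheme" (structure)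
  assumes ident_hom: "Ident A \<in> Hom A A"
    and compose_hom: "f \<in> Hom A B \<Longrightarrow> g \<in> Hom B C \<Longrightarrow> g \<cdot> f \<in> Hom A C"
    and ident_left: "f \<in> Hom A B \<Longrightarrow> Ident B \<cdot> f = f"
    and ident_right: "f \<in> Hom A B \<Longrightarrow> f \<cdot> Ident A = f"
    and compose_assoc: "f \<in> Hom A B \<Longrightarrow> g \<in> Hom B C \<Longrightarrow> h \<in> Hom C D \<Longrightarrow>
      h \<cdot> (g \<cdot> f) = (h \<cdot> g) \<cdot> f"

locale symmetric_monoidal_category = category +
  assumes tensor_hom: "f \<in> Hom A B \<Longrightarrow> g \<in> Hom A' B' \<Longrightarrow> f \<odot> g \<in> Hom (A \<otimes> A') (B \<otimes> B')"
    and tensor_ident: "Ident A \<odot> Ident B = Ident (A \<otimes> B)"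
    and tensor_compose: "f \<in> Hom A B \<Longrightarrow> g \<in> Hom B C \<Longrightarrow> f' \<in> Hom A' B' \<Longrightarrow> g' \<in> Hom B' C' \<Longrightarrow>
      (g \<cdot> f) \<odot> (g' \<cdot> f') = (g \<odot> g') \<cdot> (f \<odot> f')"
    and associator_hom: "Assoc A B C \<in> Hom (A \<otimes> B \<otimes> C) (A \<otimes> (B \<otimes> C))"
    and associator_inv_hom: "AssocInv A B C \<in> Hom (A \<otimes> (B \<otimes> C)) (A \<otimes> B \<otimes> C)"
    and associator_iso: "AssocInv A B C \<cdot> Assoc A B C = Ident (A \<otimes> B \<otimes> C)"
      "Assoc A B C \<cdot> AssocInv A B C = Ident (A \<otimes> (B \<otimes> C))"
    and associator_natural: "f \<in> Hom A A' \<Longrightarrow> g \<in> Hom B B' \<Longrightarrow> h \<in> Hom C C' \<Longrightarrow>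
      Assoc A' B' C' \<cdot> ((f \<odot> g) \<odot> h) = (f \<odot> (g \<odot> h)) \<cdot> Assoc A B C"
    and left_unitor_hom: "Lunit A \<in> Hom (\<one> \<otimes> A) A"
    and left_unitor_inv_hom: "LunitInv A \<in> Hom A (\<one> \<otimes> A)"
    and left_unitor_iso: "LunitInv A \<cdot> Lunit A = Ident (\<one> \<otimes> A)" "Lunit A \<cdot> LunitInv A = Ident A"
    and left_unitor_natural: "f \<in> Hom A B \<Longrightarrow> Lunit B \<cdot> (Ident \<one> \<odot> f) = f \<cdot> Lunit A"
    and right_unitor_hom: "Runit A \<in> Hom (A \<otimes> \<one>) A"
    and right_unitor_inv_hom: "RunitInv A \<in> Hom A (A \<otimes> \<one>)"
    and right_unitor_iso: "RunitInv A \<cdot> Runit A = Ident (A \<otimes> \<one>)" "Runit A \<cdot> RunitInv A = Ident A"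
    and right_unitor_natural: "f \<in> Hom A B \<Longrightarrow> Runit B \<cdot> (f \<odot> Ident \<one>) = f \<cdot> Runit A"
    and symmetry_hom: "Swap A B \<in> Hom (A \<otimes> B) (B \<otimes> A)"
    and symmetry_natural: "f \<in> Hom A A' \<Longrightarrow> g \<in> Hom B B' \<Longrightarrow>
      Swap A' B' \<cdot> (f \<odot> g) = (g \<odot> f) \<cdot> Swap A B"
    and symmetry_involutive: "Swap B A \<cdot> Swap A B = Ident (A \<otimes> B)"
    and pentagon: "Assoc A B (C \<otimes> D) \<cdot> Assoc (A \<otimes> B) C D =
      (Ident A \<odot> Assoc B C D) \<cdot> Assoc A (B \<otimes> C) D \<cdot> (Assoc A B C \<odot> Ident D)"
    and triangle: "(Ident A \<odot> Lunit B) \<cdot> Assoc A \<one> B = Runit A \<odot> Ident B"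
    and hexagon: "Assoc B C A \<cdot> Swap A (B \<otimes> C) \<cdot> Assoc A B C =
      (Ident B \<odot> Swap A C) \<cdot> Assoc B A C \<cdot> (Swap A B \<odot> Ident C)"

text \<open>The canonical map from \<open>(A \<otimes> B) \<otimes> (C \<otimes> D)\<close> to \<open>(A \<otimes> C) \<otimes> (B \<otimes> D)\<close>.\<close>

definition exchange ::
    "('o, 'm, 'z) ll_structure_scheme \<Rightarrow> 'o \<Rightarrow> 'o \<Rightarrow> 'o \<Rightarrow> 'o \<Rightarrow> 'm" ("Exch\<index>") where
  "Exch\<^bsub>L\<^esub> A B C D =
     AssocInv\<^bsub>L\<^esub> A C (B \<otimes>\<^bsub>L\<^esub> D) \<cdot>\<^bsub>L\<^esub>
     (Ident\<^bsub>L\<^esub> A \<odot>\<^bsub>L\<^esub>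
       (Assoc\<^bsub>L\<^esub> C B D \<cdot>\<^bsub>L\<^esub> (Swap\<^bsub>L\<^esub> B C \<odot>\<^bsub>L\<^esub> Ident\<^bsub>L\<^esub> D) \<cdot>\<^bsub>L\<^esub> AssocInv\<^bsub>L\<^esub> B C D)) \<cdot>\<^bsub>L\<^esub>
     Assoc\<^bsub>L\<^esub> A B (C \<otimes>\<^bsub>L\<^esub> D)"

text \<open>Barr's definition: a full and faithful contravariant duality with a natural bijection
  between \<open>Hom (A \<otimes> B) (dual_ob C)\<close> and \<open>Hom A (dual_ob (B \<otimes> C))\<close>. A compact closed category is the
  case where \<open>dual_ob (B \<otimes> C)\<close> is \<open>dual_ob B \<otimes> dual_ob C\<close>.\<close>

locale star_autonomous_category = symmetric_monoidal_category +
  assumes dual_ident: "dual L (Ident A) = Ident (dual_ob L A)"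
    and dual_compose: "f \<in> Hom A B \<Longrightarrow> g \<in> Hom B C \<Longrightarrow> dual L (g \<cdot> f) = dual L f \<cdot> dual L g"
    and dual_full_faithful: "bij_betw (dual L) (Hom A B) (Hom (dual_ob L B) (dual_ob L A))"
    and curry_dual_bij: "bij_betw (curry_dual L A B C)
      (Hom (A \<otimes> B) (dual_ob L C)) (Hom A (dual_ob L (B \<otimes> C)))"
    and curry_dual_natural:
      "f \<in> Hom A' A \<Longrightarrow> g \<in> Hom B' B \<Longrightarrow> h \<in> Hom C' C \<Longrightarrow> k \<in> Hom (A \<otimes> B) (dual_ob L C) \<Longrightarrow>
       curry_dual L A' B' C' (dual L h \<cdot> k \<cdot> (f \<odot> g)) =
       dual L (g \<odot> h) \<cdot> curry_dual L A B C k \<cdot> f"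

text \<open>Every hom-set is a commutative monoid and all the operations are linear.\<close>

locale preadditive_star_autonomous_category = star_autonomous_category +
  assumes zero_hom: "zero_mor L A B \<in> Hom A B"
    and add_hom: "f \<in> Hom A B \<Longrightarrow> g \<in> Hom A B \<Longrightarrow> f \<oplus> g \<in> Hom A B"
    and add_zero: "f \<in> Hom A B \<Longrightarrow> f \<oplus> zero_mor L A B = f"
    and add_commute: "f \<in> Hom A B \<Longrightarrow> g \<in> Hom A B \<Longrightarrow> f \<oplus> g = g \<oplus> f"
    and add_assoc: "f \<in> Hom A B \<Longrightarrow> g \<in> Hom A B \<Longrightarrow> h \<in> Hom A B \<Longrightarrow>
      (f \<oplus> g) \<oplus> h = f \<oplus> (g \<oplus> h)"
    and compose_zero_left: "f \<in> Hom A B \<Longrightarrow> zero_mor L B C \<cdot> f = zero_mor L A C"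
    and compose_zero_right: "g \<in> Hom B C \<Longrightarrow> g \<cdot> zero_mor L A B = zero_mor L A C"
    and compose_add_left: "f \<in> Hom A B \<Longrightarrow> g \<in> Hom B C \<Longrightarrow> g' \<in> Hom B C \<Longrightarrow>
      (g \<oplus> g') \<cdot> f = (g \<cdot> f) \<oplus> (g' \<cdot> f)"
    and compose_add_right: "f \<in> Hom A B \<Longrightarrow> f' \<in> Hom A B \<Longrightarrow> g \<in> Hom B C \<Longrightarrow>
      g \<cdot> (f \<oplus> f') = (g \<cdot> f) \<oplus> (g \<cdot> f')"
    and tensor_zero_left: "g \<in> Hom A' B' \<Longrightarrow> zero_mor L A B \<odot> g = zero_mor L (A \<otimes> A') (B \<otimes> B')"
    and tensor_zero_right: "f \<in> Hom A B \<Longrightarrow> f \<odot> zero_mor L A' B' = zero_mor L (A \<otimes> A') (B \<otimes> B')"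
    and tensor_add_left: "f \<in> Hom A B \<Longrightarrow> f' \<in> Hom A B \<Longrightarrow> g \<in> Hom A' B' \<Longrightarrow>
      (f \<oplus> f') \<odot> g = (f \<odot> g) \<oplus> (f' \<odot> g)"
    and tensor_add_right: "f \<in> Hom A B \<Longrightarrow> g \<in> Hom A' B' \<Longrightarrow> g' \<in> Hom A' B' \<Longrightarrow>
      f \<odot> (g \<oplus> g') = (f \<odot> g) \<oplus> (f \<odot> g')"
    and dual_zero: "dual L (zero_mor L A B) = zero_mor L (dual_ob L B) (dual_ob L A)"
    and dual_add: "f \<in> Hom A B \<Longrightarrow> g \<in> Hom A B \<Longrightarrow> dual L (f \<oplus> g) = dual L f \<oplus> dual L g"
    and curry_dual_zero: "curry_dual L A B C (zero_mor L (A \<otimes> B) (dual_ob L C)) =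
      zero_mor L A (dual_ob L (B \<otimes> C))"
    and curry_dual_add:
      "f \<in> Hom (A \<otimes> B) (dual_ob L C) \<Longrightarrow> g \<in> Hom (A \<otimes> B) (dual_ob L C) \<Longrightarrow>
       curry_dual L A B C (f \<oplus> g) = curry_dual L A B C f \<oplus> curry_dual L A B C g"

text \<open>A model of promotion-free differential linear logic: an exponential structure in the sense
  of Ehrhard on a preadditive *-autonomous category. The six families of morphisms are natural,
  weakening, contraction, coweakening and cocontraction form a commutative and cocommutative
  bialgebra on each \<open>!A\<close>, and dereliction and codereliction obey the remaining cut elimination
  rules. Digging and the two monoidality maps of the structure interpret promotion, which this logic
  does not have, and are not constrained here.\<close>

locale dill0_model = preadditive_star_autonomous_category L
  for L :: "('o, 'm, 'z) ll_structure_scheme" (structure) +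
  fixes codereliction coweakening cocontraction :: "'o \<Rightarrow> 'm"
  assumes bang_hom: "f \<in> Hom A B \<Longrightarrow> bang L f \<in> Hom (bang_ob L A) (bang_ob L B)"
    and bang_ident: "bang L (Ident A) = Ident (bang_ob L A)"
    and bang_compose: "f \<in> Hom A B \<Longrightarrow> g \<in> Hom B C \<Longrightarrow> bang L (g \<cdot> f) = bang L g \<cdot> bang L f"
    and weakening_hom: "weakening L A \<in> Hom (bang_ob L A) \<one>"
    and contraction_hom: "contraction L A \<in> Hom (bang_ob L A) (bang_ob L A \<otimes> bang_ob L A)"
    and dereliction_hom: "dereliction L A \<in> Hom (bang_ob L A) A"
    and coweakening_hom: "coweakening A \<in> Hom \<one> (bang_ob L A)"
    and cocontraction_hom: "cocontraction A \<in> Hom (bang_ob L A \<otimes> bang_ob L A) (bang_ob L A)"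
    and codereliction_hom: "codereliction A \<in> Hom A (bang_ob L A)"
    and weakening_natural: "f \<in> Hom A B \<Longrightarrow> weakening L B \<cdot> bang L f = weakening L A"
    and contraction_natural: "f \<in> Hom A B \<Longrightarrow>
      contraction L B \<cdot> bang L f = (bang L f \<odot> bang L f) \<cdot> contraction L A"
    and dereliction_natural: "f \<in> Hom A B \<Longrightarrow> dereliction L B \<cdot> bang L f = f \<cdot> dereliction L A"
    and coweakening_natural: "f \<in> Hom A B \<Longrightarrow> bang L f \<cdot> coweakening A = coweakening B"
    and cocontraction_natural: "f \<in> Hom A B \<Longrightarrow>
      bang L f \<cdot> cocontraction A = cocontraction B \<cdot> (bang L f \<odot> bang L f)"
    and codereliction_natural: "f \<in> Hom A B \<Longrightarrow> bang L f \<cdot> codereliction A = codereliction B \<cdot> f"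
    and contraction_counit:
      "Lunit (bang_ob L A) \<cdot> (weakening L A \<odot> Ident (bang_ob L A)) \<cdot> contraction L A =
       Ident (bang_ob L A)"
    and contraction_coassoc:
      "Assoc (bang_ob L A) (bang_ob L A) (bang_ob L A) \<cdot>
         (contraction L A \<odot> Ident (bang_ob L A)) \<cdot> contraction L A =
       (Ident (bang_ob L A) \<odot> contraction L A) \<cdot> contraction L A"
    and contraction_cocomm: "Swap (bang_ob L A) (bang_ob L A) \<cdot> contraction L A = contraction L A"
    and cocontraction_unit:
      "cocontraction A \<cdot> (coweakening A \<odot> Ident (bang_ob L A)) \<cdot> LunitInv (bang_ob L A) =
       Ident (bang_ob L A)"
    and cocontraction_assoc:
      "cocontraction A \<cdot> (cocontraction A \<odot> Ident (bang_ob L A)) =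
       cocontraction A \<cdot> (Ident (bang_ob L A) \<odot> cocontraction A) \<cdot>
         Assoc (bang_ob L A) (bang_ob L A) (bang_ob L A)"
    and cocontraction_comm: "cocontraction A \<cdot> Swap (bang_ob L A) (bang_ob L A) = cocontraction A"
    and weakening_coweakening: "weakening L A \<cdot> coweakening A = Ident \<one>"
    and weakening_cocontraction:
      "weakening L A \<cdot> cocontraction A = Lunit \<one> \<cdot> (weakening L A \<odot> weakening L A)"
    and contraction_coweakening:
      "contraction L A \<cdot> coweakening A = (coweakening A \<odot> coweakening A) \<cdot> LunitInv \<one>"
    and contraction_cocontraction:
      "contraction L A \<cdot> cocontraction A =
       (cocontraction A \<odot> cocontraction A) \<cdot>
         Exch (bang_ob L A) (bang_ob L A) (bang_ob L A) (bang_ob L A) \<cdot>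
         (contraction L A \<odot> contraction L A)"
    and dereliction_codereliction: "dereliction L A \<cdot> codereliction A = Ident A"
    and dereliction_coweakening: "dereliction L A \<cdot> coweakening A = zero_mor L \<one> A"
    and dereliction_cocontraction:
      "dereliction L A \<cdot> cocontraction A =
       (Runit A \<cdot> (dereliction L A \<odot> weakening L A)) \<oplus>
       (Lunit A \<cdot> (weakening L A \<odot> dereliction L A))"
    and weakening_codereliction: "weakening L A \<cdot> codereliction A = zero_mor L A \<one>"
    and contraction_codereliction:
      "contraction L A \<cdot> codereliction A =
       ((codereliction A \<odot> coweakening A) \<cdot> RunitInv A) \<oplus>
       ((coweakening A \<odot> codereliction A) \<cdot> LunitInv A)"


section \<open>The relational model\<close>

text \<open>The objects of a category in HOL are the elements of one type, whereas \<open>A \<times> B\<close> and \<open>!A\<close> live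
  in other types than \<open>A\<close> and \<open>B\<close>. The following type is closed under pairing, the one-point set and
  finitely supported functions; objects are all subsets of it. The parameter \<open>'x\<close> is arbitrary, and
  every set \<open>X\<close> over \<open>'x\<close> is present as the object \<open>Atom ` X\<close>.\<close>

datatype ('x, 's) elt =
    Atom 'x
  | Star
  | Tup "('x, 's) elt" "('x, 's) elt"
  | Graph "(('x, 's) elt \<times> 's) fset"

text \<open>A finitely supported function as an element: its graph restricted to its support. This is
  injective.\<close>

definition fn :: "(('x, 's) elt \<Rightarrow>\<^sub>0 's::zero) \<Rightarrow> ('x, 's) elt" where
  "fn f = Graph (Abs_fset ((\<lambda>a. (a, Poly_Mapping.lookup f a)) ` Poly_Mapping.keys f))"

type_synonym ('x, 's) rel_object = "('x, 's) elt set"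
type_synonym ('x, 's) relation = "(('x, 's) elt \<times> ('x, 's) elt) set"

definition rel_tensor_ob :: "('x, 's) rel_object \<Rightarrow> ('x, 's) rel_object \<Rightarrow> ('x, 's) rel_object" where
  "rel_tensor_ob A B = {Tup a b | a b. a \<in> A \<and> b \<in> B}"

definition rel_tensor :: "('x, 's) relation \<Rightarrow> ('x, 's) relation \<Rightarrow> ('x, 's) relation" where
  "rel_tensor r r' = {(Tup a a', Tup b b') | a a' b b'. (a, b) \<in> r \<and> (a', b') \<in> r'}"

definition rel_associator ::
    "('x, 's) rel_object \<Rightarrow> ('x, 's) rel_object \<Rightarrow> ('x, 's) rel_object \<Rightarrow> ('x, 's) relation" where
  "rel_associator A B C =
     {(Tup (Tup a b) c, Tup a (Tup b c)) | a b c. a \<in> A \<and> b \<in> B \<and> c \<in> C}"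

definition rel_left_unitor :: "('x, 's) rel_object \<Rightarrow> ('x, 's) relation" where
  "rel_left_unitor A = {(Tup Star a, a) | a. a \<in> A}"

definition rel_right_unitor :: "('x, 's) rel_object \<Rightarrow> ('x, 's) relation" where
  "rel_right_unitor A = {(Tup a Star, a) | a. a \<in> A}"

definition rel_symmetry :: "('x, 's) rel_object \<Rightarrow> ('x, 's) rel_object \<Rightarrow> ('x, 's) relation" where
  "rel_symmetry A B = {(Tup a b, Tup b a) | a b. a \<in> A \<and> b \<in> B}"

definition rel_curry :: "('x, 's) relation \<Rightarrow> ('x, 's) relation" where
  "rel_curry r = {(a, Tup b c) | a b c. (Tup a b, c) \<in> r}"

text \<open>In the sums below, \<open>\<Sum>b. t b\<close> over a whole type is the library's sum over the finitely many
  \<open>b\<close> with \<open>t b \<noteq> 0\<close>.\<close>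

definition rel_bang_ob :: "('x, 's::zero) rel_object \<Rightarrow> ('x, 's) rel_object" where
  "rel_bang_ob A = {fn f | f. Poly_Mapping.keys f \<subseteq> A}"

definition rel_bang :: "('x, 's::comm_monoid_add) relation \<Rightarrow> ('x, 's) relation" where
  "rel_bang r = {(fn f, fn g) | f g. \<exists>\<sigma> :: (('x, 's) elt \<times> ('x, 's) elt) \<Rightarrow>\<^sub>0 's.
     Poly_Mapping.keys \<sigma> \<subseteq> r \<and>
     (\<forall>a. Poly_Mapping.lookup f a = (\<Sum>b. Poly_Mapping.lookup \<sigma> (a, b))) \<and>
     (\<forall>b. Poly_Mapping.lookup g b = (\<Sum>a. Poly_Mapping.lookup \<sigma> (a, b)))}"

definition rel_weakening :: "('x, 's::zero) rel_object \<Rightarrow> ('x, 's) relation" where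
  "rel_weakening A = {(fn 0, Star)}"

definition rel_contraction :: "('x, 's::comm_monoid_add) rel_object \<Rightarrow> ('x, 's) relation" where
  "rel_contraction A = {(fn (f + g), Tup (fn f) (fn g)) | f g.
     Poly_Mapping.keys f \<subseteq> A \<and> Poly_Mapping.keys g \<subseteq> A}"

definition rel_dereliction :: "('x, 's::zero_neq_one) rel_object \<Rightarrow> ('x, 's) relation" where
  "rel_dereliction A = {(fn (Poly_Mapping.single a 1), a) | a. a \<in> A}"

definition rel_digging :: "('x, 's::semiring_1) rel_object \<Rightarrow> ('x, 's) relation" where
  "rel_digging A = {(fn g, fn F) | g F. Poly_Mapping.keys F \<subseteq> rel_bang_ob A \<and>
     (\<forall>a. Poly_Mapping.lookup g a = (\<Sum>f. Poly_Mapping.lookup F (fn f) * Poly_Mapping.lookup f a))}"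

definition rel_monoidality_unit :: "('x, 's::zero) relation" where
  "rel_monoidality_unit = {(Star, fn f) | f. Poly_Mapping.keys f \<subseteq> {Star}}"

definition rel_monoidality ::
    "('x, 's::comm_monoid_add) rel_object \<Rightarrow> ('x, 's) rel_object \<Rightarrow> ('x, 's) relation" where
  "rel_monoidality A B = {(Tup (fn f) (fn g), fn \<sigma>) | f g \<sigma>.
     Poly_Mapping.keys \<sigma> \<subseteq> rel_tensor_ob A B \<and>
     (\<forall>a. Poly_Mapping.lookup f a = (\<Sum>b. Poly_Mapping.lookup \<sigma> (Tup a b))) \<and>
     (\<forall>b. Poly_Mapping.lookup g b = (\<Sum>a. Poly_Mapping.lookup \<sigma> (Tup a b)))}"

type_synonym ('x, 's) rel_structure = "(('x, 's) rel_object, ('x, 's) relation) ll_structure"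

definition rel_model :: "('x, 's::resource_semiring) rel_structure" where
  "rel_model = \<lparr>
     hom = (\<lambda>A B. Pow (A \<times> B)),
     ident = Id_on,
     compose = (\<lambda>s r. r O s),
     unit_ob = {Star},
     tensor_ob = rel_tensor_ob,
     tensor = rel_tensor,
     associator = rel_associator,
     associator_inv = (\<lambda>A B C. (rel_associator A B C)\<inverse>),
     left_unitor = rel_left_unitor,
     left_unitor_inv = (\<lambda>A. (rel_left_unitor A)\<inverse>),
     right_unitor = rel_right_unitor,
     right_unitor_inv = (\<lambda>A. (rel_right_unitor A)\<inverse>),
     symmetry = rel_symmetry,
     dual_ob = (\<lambda>A. A),
     dual = (\<lambda>r. {(a, b). (b, a) \<in> r}),
     curry_dual = (\<lambda>A B C. rel_curry),
     zero_mor = (\<lambda>A B. {}),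
     add_mor = (\<union>),
     bang_ob = rel_bang_ob,
     bang = rel_bang,
     weakening = rel_weakening,
     contraction = rel_contraction,
     dereliction = rel_dereliction,
     digging = rel_digging,
     monoidality_unit = rel_monoidality_unit,
     monoidality = rel_monoidality \<rparr>"

end

theory Submission
  imports Defs
begin

text \<open>
  A pair of \<open>!r\<close> is the pair of marginals of a finitely supported weight on \<open>r\<close>, so everything
  reduces to pushing weights forward along functions. Iterating additive splitting shows that a
  decomposition of a pushforward lifts to a decomposition of the weight, and hence that two weights
  with the same pushforward come from a weight on the fibre product: this is the functoriality of
  \<open>!\<close> on composites, while the decomposition of weights gives the naturality of contraction and the
  bialgebra law. Positivity handles weakening and discreteness handles dereliction, since they say
  that a weight of mass 0 vanishes and that one of mass 1 is a Dirac mass. Finally \<open>!\<close> commutes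
  with converse, so each law for a co-structure is the converse of a law for the structure.
\<close>

section \<open>Pushing weights forward\<close>

text \<open>Weights are built by adding point masses, with no freshness condition on the key. This
  suits \<open>push\<close>, which is additive and explicit on point masses.\<close>

lemma poly_mapping_add_single_induct [case_names zero add]:
  fixes f :: "'a \<Rightarrow>\<^sub>0 'b::monoid_add"
  assumes zero: "P 0"
    and add: "\<And>f a b. P f \<Longrightarrow> P (f + Poly_Mapping.single a b)"
  shows "P f"
proof (induction f rule: Poly_Mapping.update_induct)
  case const
  show ?case by (rule zero)
next
  case (update f a b)
  have "Poly_Mapping.update a b f = f + Poly_Mapping.single a b"
    using update.hyps
    by (intro poly_mapping_eqI) (auto simp: lookup_update lookup_add lookup_single in_keys_iff)
  then show ?case using add update.IH by simp
qed

lemma poly_mapping_remove_key: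
  fixes f :: "'a \<Rightarrow>\<^sub>0 'b::monoid_add"
  obtains g where "f = g + Poly_Mapping.single a (Poly_Mapping.lookup f a)"
proof
  show "f = Poly_Mapping.update a 0 f + Poly_Mapping.single a (Poly_Mapping.lookup f a)"
    by (intro poly_mapping_eqI) (auto simp: lookup_update lookup_add lookup_single)
qed

text \<open>Image of a weight under a map: the value at a point is the sum of
  \<open>\<sigma>\<close> over its fibre. Written as a sum of point masses, it is finitely supported
  by construction.\<close>

definition push :: "('a \<Rightarrow> 'b) \<Rightarrow> ('a \<Rightarrow>\<^sub>0 's) \<Rightarrow> 'b \<Rightarrow>\<^sub>0 's::comm_monoid_add" where
  "push h \<sigma> = (\<Sum>p\<in>Poly_Mapping.keys \<sigma>. Poly_Mapping.single (h p) (Poly_Mapping.lookup \<sigma> p))"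

lemma push_zero [simp]: "push h 0 = 0"
  by (simp add: push_def)

lemma push_single [simp]: "push h (Poly_Mapping.single p x) = Poly_Mapping.single (h p) x"
  by (simp add: push_def)

lemma push_add: "push h (\<sigma> + \<tau>) = push h \<sigma> + push h \<tau>"
  unfolding push_def by (rule setsum_keys_plus_distrib) (simp_all add: single_add)

lemma push_push: "push h (push k \<sigma>) = push (\<lambda>p. h (k p)) \<sigma>"
  by (induction \<sigma> rule: poly_mapping_add_single_induct) (simp_all add: push_add)

lemma push_id: "push (\<lambda>p. p) \<sigma> = \<sigma>"
  by (induction \<sigma> rule: poly_mapping_add_single_induct) (simp_all add: push_add)

lemma push_cong: "(\<And>p. p \<in> Poly_Mapping.keys \<sigma> \<Longrightarrow> h p = k p) \<Longrightarrow> push h \<sigma> = push k \<sigma>"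
  by (simp add: push_def)

lemma finite_lookup_comp:
  "inj i \<Longrightarrow> finite {b. Poly_Mapping.lookup \<sigma> (i b) \<noteq> 0}"
  using finite_vimageI[of "Poly_Mapping.keys \<sigma>" i] by (simp add: vimage_def in_keys_iff)

text \<open>Bridge from the sums in the definition of \<open>rel_bang\<close> to
  \<open>push\<close>: \<open>i\<close> parametrises the fibre of \<open>h\<close> over
  \<open>a\<close> without repetition.\<close>

lemma Sum_any_lookup_push:
  assumes "inj i" and fibre: "\<And>p. h p = a \<longleftrightarrow> p \<in> range i"
  shows "Sum_any (\<lambda>b. Poly_Mapping.lookup \<sigma> (i b)) = Poly_Mapping.lookup (push h \<sigma>) a"
proof (induction \<sigma> rule: poly_mapping_add_single_induct)
  case zero
  show ?case by simp
next
  case (add \<sigma> p x)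
  have "Sum_any (\<lambda>b. Poly_Mapping.lookup (Poly_Mapping.single p x) (i b)) =
    Poly_Mapping.lookup (Poly_Mapping.single (h p) x) a"
  proof (cases "h p = a")
    case True
    then obtain b where b: "p = i b" using fibre by blast
    have "Poly_Mapping.lookup (Poly_Mapping.single p x) (i b') = (if b = b' then x else 0)" for b'
      using \<open>inj i\<close> by (auto simp: b lookup_single when_def dest: injD)
    then show ?thesis using True by simp
  next
    case False
    then have "Poly_Mapping.lookup (Poly_Mapping.single p x) (i b) = 0" for b
      using fibre by (auto simp: lookup_single when_def)
    then show ?thesis using False by (simp add: lookup_single)
  qed
  then show ?case
    by (simp add: lookup_add push_add add Sum_any.distrib finite_lookup_comp[OF \<open>inj i\<close>])
qed

text \<open>Only an inclusion, since in a general commutative monoid the masses in a fibre may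
  cancel. Positivity gives the equality \<open>keys_push\<close>.\<close>

lemma keys_push_subset: "Poly_Mapping.keys (push h \<sigma>) \<subseteq> h ` Poly_Mapping.keys \<sigma>"
  unfolding push_def using keys_sum by (fastforce split: if_splits)


section \<open>Weights in a resource semiring\<close>

text \<open>Positivity makes one summand vanish, and then the other equals the sum, which is 0. This
  excludes all cancellation below.\<close>

lemma add_eq_0_iff_resource: "x + y = 0 \<longleftrightarrow> x = 0 \<and> y = (0::'s::resource_semiring)"
  using positive[of x y] by auto

lemma poly_mapping_add_eq_0_iff:
  "f + g = 0 \<longleftrightarrow> f = 0 \<and> g = (0 :: 'a \<Rightarrow>\<^sub>0 's::resource_semiring)"
  by (auto simp: poly_mapping_eq_iff lookup_add fun_eq_iff add_eq_0_iff_resource)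

lemma keys_add_resource:
  fixes f g :: "'a \<Rightarrow>\<^sub>0 's::resource_semiring"
  shows "Poly_Mapping.keys (f + g) = Poly_Mapping.keys f \<union> Poly_Mapping.keys g"
  by (auto simp: in_keys_iff lookup_add add_eq_0_iff_resource)

lemma keys_push:
  fixes \<sigma> :: "'a \<Rightarrow>\<^sub>0 's::resource_semiring"
  shows "Poly_Mapping.keys (push h \<sigma>) = h ` Poly_Mapping.keys \<sigma>"
  by (induction \<sigma> rule: poly_mapping_add_single_induct) (auto simp: push_add keys_add_resource)

lemma push_eq_0_iff:
  fixes \<sigma> :: "'a \<Rightarrow>\<^sub>0 's::resource_semiring"
  shows "push h \<sigma> = 0 \<longleftrightarrow> \<sigma> = 0"
  using keys_push[of h \<sigma>] by (metis image_is_empty keys_eq_empty)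

text \<open>The splitting is chosen separately at each key. Every piece is a summand of
  \<open>f1\<close> or \<open>f2\<close>, so by positivity it vanishes wherever both do, which gives
  finite support.\<close>

lemma poly_mapping_additive_splitting:
  fixes f1 f2 f3 f4 :: "'a \<Rightarrow>\<^sub>0 's::resource_semiring"
  assumes "f1 + f2 = f3 + f4"
  obtains f13 f14 f23 f24 where
    "f1 = f13 + f14" "f2 = f23 + f24" "f3 = f13 + f23" "f4 = f14 + f24"
proof -
  let ?l = Poly_Mapping.lookup
  have "\<forall>a. \<exists>x13 x14 x23 x24. ?l f1 a = x13 + x14 \<and> ?l f2 a = x23 + x24 \<and>
      ?l f3 a = x13 + x23 \<and> ?l f4 a = x14 + x24"
    using assms by (metis additive_splitting lookup_add)
  then obtain x13 x14 x23 x24 where x: "\<And>a. ?l f1 a = x13 a + x14 a" "\<And>a. ?l f2 a = x23 a + x24 a"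
      "\<And>a. ?l f3 a = x13 a + x23 a" "\<And>a. ?l f4 a = x14 a + x24 a"
    by metis
  have fin: "finite {a. y a \<noteq> 0}" if "\<And>a. y a \<noteq> 0 \<Longrightarrow> ?l f1 a \<noteq> 0 \<or> ?l f2 a \<noteq> 0" for y :: "'a \<Rightarrow> 's"
    by (rule finite_subset[of _ "Poly_Mapping.keys f1 \<union> Poly_Mapping.keys f2"])
      (auto simp: in_keys_iff dest: that)
  have "?l (Abs_poly_mapping x13) = x13" "?l (Abs_poly_mapping x14) = x14"
      "?l (Abs_poly_mapping x23) = x23" "?l (Abs_poly_mapping x24) = x24"
    by (simp_all add: Abs_poly_mapping_inverse fin x add_eq_0_iff_resource)
  note [simp] = this
  show thesis
    by (rule that[of "Abs_poly_mapping x13" "Abs_poly_mapping x14" "Abs_poly_mapping x23"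
          "Abs_poly_mapping x24"]) (simp_all add: poly_mapping_eq_iff fun_eq_iff lookup_add x)
qed

lemma single_eq_addD:
  fixes f g :: "'a \<Rightarrow>\<^sub>0 's::resource_semiring"
  assumes "Poly_Mapping.single a x = f + g"
  shows "f = Poly_Mapping.single a (Poly_Mapping.lookup f a)"
proof -
  have "Poly_Mapping.keys f \<subseteq> {a}"
    using assms keys_add_resource[of f g] by (metis Un_upper1 keys_single empty_subsetI order_trans)
  then show ?thesis
    by (intro poly_mapping_eqI) (auto simp: lookup_single when_def in_keys_iff)
qed

text \<open>Induction on \<open>\<sigma>\<close>: the two-by-two splitting separates the problem
  into one for the earlier part of \<open>\<sigma>\<close>, solved by induction, and one for the
  added point mass.\<close>

lemma push_splitting:
  fixes \<sigma> :: "'a \<Rightarrow>\<^sub>0 's::resource_semiring"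
  assumes "push h \<sigma> = f + g"
  obtains \<sigma>1 \<sigma>2 where "\<sigma> = \<sigma>1 + \<sigma>2" "push h \<sigma>1 = f" "push h \<sigma>2 = g"
proof -
  have "\<exists>\<sigma>1 \<sigma>2. \<sigma> = \<sigma>1 + \<sigma>2 \<and> push h \<sigma>1 = f \<and> push h \<sigma>2 = g"
    using assms
  proof (induction \<sigma> arbitrary: f g rule: poly_mapping_add_single_induct)
    case zero
    then show ?case by (metis add_0 poly_mapping_add_eq_0_iff push_zero)
  next
    case (add \<sigma> p x)
    then have "push h \<sigma> + Poly_Mapping.single (h p) x = f + g"
      by (simp add: push_add)
    then obtain f1 g1 f2 g2 where *: "push h \<sigma> = f1 + g1" "Poly_Mapping.single (h p) x = f2 + g2"
        "f = f1 + f2" "g = g1 + g2"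
      by (rule poly_mapping_additive_splitting)
    obtain \<sigma>1 \<sigma>2 where \<sigma>: "\<sigma> = \<sigma>1 + \<sigma>2" "push h \<sigma>1 = f1" "push h \<sigma>2 = g1"
      using add.IH[OF *(1)] by blast
    \<comment> \<open>The summands of a point mass at \<open>h p\<close> are point masses at
      \<open>h p\<close>; their values prescribe how to divide the mass \<open>x\<close> lying at
      \<open>p\<close>.\<close>
    let ?y = "Poly_Mapping.lookup f2 (h p)" and ?z = "Poly_Mapping.lookup g2 (h p)"
    have f2: "f2 = Poly_Mapping.single (h p) ?y"
      using *(2) by (rule single_eq_addD)
    have g2: "g2 = Poly_Mapping.single (h p) ?z"
      using *(2) single_eq_addD[of "h p" x g2 f2] by (simp add: add.commute)
    have "x = ?y + ?z"
      using arg_cong[OF *(2), of "\<lambda>u. Poly_Mapping.lookup u (h p)"] by (simp add: lookup_add)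
    then have "\<sigma> + Poly_Mapping.single p x =
        (\<sigma>1 + Poly_Mapping.single p ?y) + (\<sigma>2 + Poly_Mapping.single p ?z)"
      unfolding \<sigma>(1) by (metis (no_types) single_add add.assoc add.left_commute)
    moreover have "push h (\<sigma>1 + Poly_Mapping.single p ?y) = f"
      using f2 by (simp add: push_add \<sigma> *)
    moreover have "push h (\<sigma>2 + Poly_Mapping.single p ?z) = g"
      using g2 by (simp add: push_add \<sigma> *)
    ultimately show ?case by blast
  qed
  then show thesis using that by blast
qed

text \<open>\<open>\<rho>\<close> is a coupling of \<open>\<sigma>\<close> and \<open>\<tau>\<close>
  carried by the fibre product of \<open>h\<close> and \<open>k\<close>. The induction couples each
  point mass of \<open>\<sigma>\<close> with the portion of \<open>\<tau>\<close> that
  \<open>push_splitting\<close> assigns to it.\<close>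

lemma push_pullback:
  fixes \<sigma> :: "'a \<Rightarrow>\<^sub>0 's::resource_semiring" and \<tau> :: "'b \<Rightarrow>\<^sub>0 's"
  assumes "push h \<sigma> = push k \<tau>"
  obtains \<rho> where "\<And>p q. (p, q) \<in> Poly_Mapping.keys \<rho> \<Longrightarrow> h p = k q"
    "push fst \<rho> = \<sigma>" "push snd \<rho> = \<tau>"
proof -
  have "\<exists>\<rho>. (\<forall>(p, q) \<in> Poly_Mapping.keys \<rho>. h p = k q) \<and> push fst \<rho> = \<sigma> \<and> push snd \<rho> = \<tau>"
    using assms
  proof (induction \<sigma> arbitrary: \<tau> rule: poly_mapping_add_single_induct)
    case zero
    then have "\<tau> = 0" by (metis push_eq_0_iff push_zero)
    then show ?case by (intro exI[of _ 0]) simp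
  next
    case (add \<sigma> p x)
    have "push k \<tau> = push h \<sigma> + Poly_Mapping.single (h p) x"
      using add.prems by (simp add: push_add)
    then obtain \<tau>1 \<tau>2 where \<tau>: "\<tau> = \<tau>1 + \<tau>2" "push k \<tau>1 = push h \<sigma>"
        "push k \<tau>2 = Poly_Mapping.single (h p) x"
      by (rule push_splitting)
    obtain \<rho> where \<rho>: "\<forall>(p, q) \<in> Poly_Mapping.keys \<rho>. h p = k q" "push fst \<rho> = \<sigma>" "push snd \<rho> = \<tau>1"
      using add.IH[of \<tau>1] \<tau>(2) by auto
    \<comment> \<open>\<open>\<tau>2\<close> lies over \<open>h p\<close>, so pairing its keys with
      \<open>p\<close> stays in the fibre product. This is an inclusion because \<open>x\<close> may
      be 0.\<close>
    have "k ` Poly_Mapping.keys \<tau>2 \<subseteq> {h p}"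
      unfolding keys_push[symmetric] \<tau>(3) by simp
    then have "\<forall>(p, q) \<in> Poly_Mapping.keys (\<rho> + push (Pair p) \<tau>2). h p = k q"
      using \<rho>(1) by (auto simp: keys_add_resource keys_push)
    \<comment> \<open>Pushing to a single point records only the total mass, which
      \<open>push k\<close> preserves.\<close>
    moreover have "push (\<lambda>_. p) \<tau>2 = Poly_Mapping.single p x"
      using push_push[of "\<lambda>_. p" k \<tau>2] \<tau>(3) by simp
    then have "push fst (\<rho> + push (Pair p) \<tau>2) = \<sigma> + Poly_Mapping.single p x"
      by (simp add: push_add push_push \<rho>)
    moreover have "push snd (\<rho> + push (Pair p) \<tau>2) = \<tau>"
      by (simp add: push_add push_push push_id \<rho> \<tau>)
    ultimately show ?case by blast
  qed
  then obtain \<rho> where "\<forall>(p, q) \<in> Poly_Mapping.keys \<rho>. h p = k q"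
    and marginals: "push fst \<rho> = \<sigma>" "push snd \<rho> = \<tau>"
    by (elim exE conjE)
  then have "h p = k q" if "(p, q) \<in> Poly_Mapping.keys \<rho>" for p q
    using that by auto
  then show thesis using marginals by (rule that)
qed

text \<open>Both summands are concentrated at \<open>a\<close>, where their values add up to 1, so
  discreteness makes one of them vanish.\<close>

lemma single_1_eq_add_iff:
  fixes f g :: "'a \<Rightarrow>\<^sub>0 's::resource_semiring"
  shows "Poly_Mapping.single a 1 = f + g \<longleftrightarrow>
    f = 0 \<and> g = Poly_Mapping.single a 1 \<or> f = Poly_Mapping.single a 1 \<and> g = 0"
proof
  assume *: "Poly_Mapping.single a 1 = f + g"
  have f: "f = Poly_Mapping.single a (Poly_Mapping.lookup f a)"
    using * by (rule single_eq_addD)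
  have g: "g = Poly_Mapping.single a (Poly_Mapping.lookup g a)"
    using * single_eq_addD[of a 1 g f] by (simp add: add.commute)
  have "Poly_Mapping.lookup f a + Poly_Mapping.lookup g a = 1"
    by (metis * lookup_add lookup_single_eq)
  then have "Poly_Mapping.lookup f a = 0 \<or> Poly_Mapping.lookup g a = 0"
    by (rule discrete)
  then show "f = 0 \<and> g = Poly_Mapping.single a 1 \<or> f = Poly_Mapping.single a 1 \<and> g = 0"
    using f g * by (metis add_0 add_0_right single_zero)
qed auto

text \<open>Separate a key \<open>p\<close> of \<open>\<sigma>\<close> from the rest. A Dirac mass
  splits only trivially and the part at \<open>p\<close> is nonzero, so the rest has image 0 and is
  itself 0.\<close>

lemma push_eq_single_1D:
  fixes \<sigma> :: "'a \<Rightarrow>\<^sub>0 's::resource_semiring"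
  assumes "push h \<sigma> = Poly_Mapping.single b 1"
  obtains p where "h p = b" "\<sigma> = Poly_Mapping.single p 1"
proof -
  have "\<sigma> \<noteq> 0" using assms by (metis push_zero single_zero lookup_single_eq lookup_zero zero_neq_one)
  then obtain p where p: "p \<in> Poly_Mapping.keys \<sigma>" using keys_eq_empty by blast
  let ?x = "Poly_Mapping.lookup \<sigma> p"
  obtain \<tau> where \<tau>: "\<sigma> = \<tau> + Poly_Mapping.single p ?x" by (rule poly_mapping_remove_key)
  have "Poly_Mapping.single b 1 = push h \<tau> + Poly_Mapping.single (h p) ?x"
    using assms by (metis \<tau> push_add push_single)
  moreover have "Poly_Mapping.single (h p) ?x \<noteq> 0"
    using p by (metis in_keys_iff lookup_single_eq lookup_zero)
  ultimately have *: "push h \<tau> = 0" "Poly_Mapping.single (h p) ?x = Poly_Mapping.single b 1"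
    by (auto simp: single_1_eq_add_iff)
  \<comment> \<open>A nonzero coefficient makes the key of a point mass recoverable, so
    \<open>h p = b\<close> can be read off before the coefficients are compared.\<close>
  have "Poly_Mapping.keys (Poly_Mapping.single (h p) ?x) = {h p}"
    using p by (simp add: in_keys_iff)
  then have "h p = b" using *(2) by simp
  moreover from this have "?x = 1" using *(2) by (metis lookup_single_eq)
  then have "\<sigma> = Poly_Mapping.single p 1"
    using \<tau> *(1) by (simp add: push_eq_0_iff)
  ultimately show thesis by (rule that)
qed


section \<open>The exponential of relations\<close>

text \<open>The first components of the graph recover the support, and off the support both
  functions are 0.\<close>

lemma fn_inject [simp]: "fn f = fn g \<longleftrightarrow> f = g"
proof
  assume "fn f = fn g"
  then have eq: "(\<lambda>a. (a, Poly_Mapping.lookup f a)) ` Poly_Mapping.keys f =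
      (\<lambda>a. (a, Poly_Mapping.lookup g a)) ` Poly_Mapping.keys g"
    by (simp add: fn_def Abs_fset_inject)
  have "Poly_Mapping.keys f = Poly_Mapping.keys g"
    using arg_cong[OF eq, of "image fst"] by (simp add: image_image)
  then have "Poly_Mapping.lookup f a = Poly_Mapping.lookup g a" if "a \<in> Poly_Mapping.keys f" for a
    using that imageI[OF that, of "\<lambda>a. (a, Poly_Mapping.lookup f a)"] unfolding eq by auto
  with \<open>Poly_Mapping.keys f = Poly_Mapping.keys g\<close> show "f = g"
    by (intro poly_mapping_eqI) (metis in_keys_iff)
qed simp

lemma rel_bang_push:
  fixes r :: "('x, 's::comm_monoid_add) relation"
  shows "rel_bang r = {(fn (push fst \<sigma>), fn (push snd \<sigma>)) | \<sigma>. Poly_Mapping.keys \<sigma> \<subseteq> r}"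
proof -
  \<comment> \<open>The remaining coordinate parametrises each fibre of a projection.\<close>
  have fst: "Sum_any (\<lambda>b. Poly_Mapping.lookup \<sigma> (a, b)) = Poly_Mapping.lookup (push fst \<sigma>) a"
    and snd: "Sum_any (\<lambda>b. Poly_Mapping.lookup \<sigma> (b, a)) = Poly_Mapping.lookup (push snd \<sigma>) a"
    for \<sigma> :: "('x, 's) elt \<times> ('x, 's) elt \<Rightarrow>\<^sub>0 's" and a
    by (rule Sum_any_lookup_push; simp add: inj_def image_iff prod_eq_iff)+
  have eqI: "(\<forall>a. Poly_Mapping.lookup f a = Poly_Mapping.lookup g a) \<longleftrightarrow> f = g"
    for f g :: "('x, 's) elt \<Rightarrow>\<^sub>0 's"
    by (auto simp: poly_mapping_eq_iff fun_eq_iff)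
  show ?thesis
    unfolding rel_bang_def fst snd eqI by blast
qed

lemma rel_bangI: "Poly_Mapping.keys \<sigma> \<subseteq> r \<Longrightarrow> (fn (push fst \<sigma>), fn (push snd \<sigma>)) \<in> rel_bang r"
  by (auto simp: rel_bang_push)

text \<open>Swapping the coordinates of a weight exchanges its two marginals.\<close>

lemma converse_rel_bang:
  fixes r :: "('x, 's::comm_monoid_add) relation"
  shows "(rel_bang r)\<inverse> = rel_bang (r\<inverse>)"
proof -
  have "rel_bang (s\<inverse>) \<subseteq> (rel_bang s)\<inverse>" for s :: "('x, 's) relation"
  proof
    fix z assume "z \<in> rel_bang (s\<inverse>)"
    then obtain \<sigma> where \<sigma>: "Poly_Mapping.keys \<sigma> \<subseteq> s\<inverse>" "z = (fn (push fst \<sigma>), fn (push snd \<sigma>))"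
      by (auto simp: rel_bang_push)
    have "Poly_Mapping.keys (push prod.swap \<sigma>) \<subseteq> s"
      using keys_push_subset[of prod.swap \<sigma>] \<sigma>(1) by fastforce
    from rel_bangI[OF this] show "z \<in> (rel_bang s)\<inverse>"
      by (simp add: \<sigma>(2) push_push)
  qed
  \<comment> \<open>The inclusion for the converse relation is the reverse inclusion for
    \<open>r\<close>.\<close>
  from this[of r] this[of "r\<inverse>"] show ?thesis by auto
qed

lemma rel_bang_subset:
  assumes "r \<subseteq> A \<times> B"
  shows "rel_bang r \<subseteq> rel_bang_ob A \<times> rel_bang_ob B"
proof -
  have "Poly_Mapping.keys (push fst \<sigma>) \<subseteq> A \<and> Poly_Mapping.keys (push snd \<sigma>) \<subseteq> B"
    if "Poly_Mapping.keys \<sigma> \<subseteq> r" for \<sigma>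
    using keys_push_subset[of fst \<sigma>] keys_push_subset[of snd \<sigma>] that assms by fastforce
  then show ?thesis unfolding rel_bang_push rel_bang_ob_def by blast
qed

text \<open>A weight on the diagonal has equal marginals, and every \<open>f\<close> arises in this
  way by pushing it along the diagonal map.\<close>

lemma rel_bang_Id_on: "rel_bang (Id_on A) = Id_on (rel_bang_ob A)"
proof
  show "rel_bang (Id_on A) \<subseteq> Id_on (rel_bang_ob A)"
  proof
    fix z assume z: "z \<in> rel_bang (Id_on A)"
    then obtain \<sigma> where \<sigma>: "Poly_Mapping.keys \<sigma> \<subseteq> Id_on A" "z = (fn (push fst \<sigma>), fn (push snd \<sigma>))"
      by (auto simp: rel_bang_push)
    have "push fst \<sigma> = push snd \<sigma>"
      using \<sigma>(1) by (intro push_cong) auto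
    moreover have "fst z \<in> rel_bang_ob A"
      using subsetD[OF rel_bang_subset[OF Id_on_subset_Times] z] by auto
    ultimately show "z \<in> Id_on (rel_bang_ob A)" by (simp add: \<sigma>(2) Id_on_iff)
  qed
  show "Id_on (rel_bang_ob A) \<subseteq> rel_bang (Id_on A)"
  proof
    fix z assume "z \<in> Id_on (rel_bang_ob A)"
    then obtain f where f: "Poly_Mapping.keys f \<subseteq> A" "z = (fn f, fn f)"
      by (auto simp: rel_bang_ob_def)
    have "Poly_Mapping.keys (push (\<lambda>a. (a, a)) f) \<subseteq> Id_on A"
      using keys_push_subset[of "\<lambda>a. (a, a)" f] f(1) by auto
    from rel_bangI[OF this] show "z \<in> rel_bang (Id_on A)"
      by (simp add: f(2) push_push push_id)
  qed
qed

text \<open>From left to right, choose a middle point for every pair in the support. Conversely,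
  \<open>push_pullback\<close> turns the equality of the middle marginals into a weight on
  composable pairs, whose middle points are then forgotten.\<close>

lemma rel_bang_relcomp:
  fixes r s :: "('x, 's::resource_semiring) relation"
  shows "rel_bang (r O s) = rel_bang r O rel_bang s"
proof
  show "rel_bang (r O s) \<subseteq> rel_bang r O rel_bang s"
  proof
    fix z assume "z \<in> rel_bang (r O s)"
    then obtain \<sigma> where \<sigma>: "Poly_Mapping.keys \<sigma> \<subseteq> r O s" "z = (fn (push fst \<sigma>), fn (push snd \<sigma>))"
      by (auto simp: rel_bang_push)
    then have "\<forall>p \<in> Poly_Mapping.keys \<sigma>. \<exists>b. (fst p, b) \<in> r \<and> (b, snd p) \<in> s"
      by fastforce
    then obtain m where m: "\<And>p. p \<in> Poly_Mapping.keys \<sigma> \<Longrightarrow> (fst p, m p) \<in> r \<and> (m p, snd p) \<in> s"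
      by metis
    have "Poly_Mapping.keys (push (\<lambda>p. (fst p, m p)) \<sigma>) \<subseteq> r"
      using m by (auto simp: keys_push)
    from rel_bangI[OF this] have "(fn (push fst \<sigma>), fn (push m \<sigma>)) \<in> rel_bang r"
      by (simp add: push_push)
    moreover have "Poly_Mapping.keys (push (\<lambda>p. (m p, snd p)) \<sigma>) \<subseteq> s"
      using m by (auto simp: keys_push)
    from rel_bangI[OF this] have "(fn (push m \<sigma>), fn (push snd \<sigma>)) \<in> rel_bang s"
      by (simp add: push_push)
    ultimately show "z \<in> rel_bang r O rel_bang s" by (auto simp: \<sigma>(2))
  qed
  show "rel_bang r O rel_bang s \<subseteq> rel_bang (r O s)"
  proof
    fix z assume "z \<in> rel_bang r O rel_bang s"
    then obtain \<sigma> \<tau> where *: "Poly_Mapping.keys \<sigma> \<subseteq> r" "Poly_Mapping.keys \<tau> \<subseteq> s"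
      "push snd \<sigma> = push fst \<tau>" "z = (fn (push fst \<sigma>), fn (push snd \<tau>))"
      by (auto simp: rel_bang_push)
    from *(3) obtain \<rho> where \<rho>: "\<And>p q. (p, q) \<in> Poly_Mapping.keys \<rho> \<Longrightarrow> snd p = fst q"
      "push fst \<rho> = \<sigma>" "push snd \<rho> = \<tau>"
      by (rule push_pullback) blast
    have in_rs: "fst w \<in> r \<and> snd w \<in> s" if "w \<in> Poly_Mapping.keys \<rho>" for w
      using *(1,2) that unfolding \<rho>(2,3)[symmetric] by (auto simp: keys_push)
    have "Poly_Mapping.keys (push (\<lambda>w. (fst (fst w), snd (snd w))) \<rho>) \<subseteq> r O s"
      using in_rs \<rho>(1) by (fastforce simp: keys_push)
    from rel_bangI[OF this] show "z \<in> rel_bang (r O s)"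
      by (simp add: *(4) push_push \<rho>(2,3)[symmetric])
  qed
qed

section \<open>Naturality of weakening, contraction and dereliction\<close>

text \<open>A weight whose target marginal is 0 is 0 itself, so its source marginal is 0 as
  well.\<close>

lemma rel_weakening_natural:
  fixes r :: "('x, 's::resource_semiring) relation"
  shows "rel_bang r O rel_weakening B = rel_weakening A"
proof -
  have "(fn 0, fn 0) \<in> rel_bang r" using rel_bangI[of 0 r] by simp
  then show ?thesis by (auto simp: rel_bang_push rel_weakening_def push_eq_0_iff)
qed

text \<open>A splitting of the target marginal lifts along \<open>snd\<close> to the weight, by
  \<open>push_splitting\<close>; in the other direction two weights on \<open>r\<close> are
  added.\<close>

lemma rel_contraction_natural:
  fixes r :: "('x, 's::resource_semiring) relation"
  assumes "r \<subseteq> A \<times> B"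
  shows "rel_bang r O rel_contraction B = rel_contraction A O rel_tensor (rel_bang r) (rel_bang r)"
proof
  have keys: "Poly_Mapping.keys (push fst \<sigma>) \<subseteq> A" "Poly_Mapping.keys (push snd \<sigma>) \<subseteq> B"
    if "Poly_Mapping.keys \<sigma> \<subseteq> r" for \<sigma> :: "('x, 's) elt \<times> ('x, 's) elt \<Rightarrow>\<^sub>0 's"
    using that assms by (auto simp: keys_push)
  show "rel_bang r O rel_contraction B \<subseteq> rel_contraction A O rel_tensor (rel_bang r) (rel_bang r)"
  proof
    fix z assume "z \<in> rel_bang r O rel_contraction B"
    then obtain \<sigma> f g where *: "Poly_Mapping.keys \<sigma> \<subseteq> r" "push snd \<sigma> = f + g"
      "z = (fn (push fst \<sigma>), Tup (fn f) (fn g))"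
      by (auto simp: rel_bang_push rel_contraction_def)
    from *(2) obtain \<sigma>1 \<sigma>2 where \<sigma>: "\<sigma> = \<sigma>1 + \<sigma>2" "push snd \<sigma>1 = f" "push snd \<sigma>2 = g"
      by (rule push_splitting)
    have k: "Poly_Mapping.keys \<sigma>1 \<subseteq> r" "Poly_Mapping.keys \<sigma>2 \<subseteq> r"
      using *(1) by (auto simp: \<sigma>(1) keys_add_resource)
    have "(fn (push fst \<sigma>), Tup (fn (push fst \<sigma>1)) (fn (push fst \<sigma>2))) \<in> rel_contraction A"
      using keys(1)[OF k(1)] keys(1)[OF k(2)] by (auto simp: rel_contraction_def \<sigma>(1) push_add)
    moreover have "(Tup (fn (push fst \<sigma>1)) (fn (push fst \<sigma>2)), Tup (fn f) (fn g))
        \<in> rel_tensor (rel_bang r) (rel_bang r)"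
      using rel_bangI[OF k(1)] rel_bangI[OF k(2)] by (simp add: rel_tensor_def \<sigma>)
    ultimately show "z \<in> rel_contraction A O rel_tensor (rel_bang r) (rel_bang r)"
      by (auto simp: *(3))
  qed
  show "rel_contraction A O rel_tensor (rel_bang r) (rel_bang r) \<subseteq> rel_bang r O rel_contraction B"
  proof
    fix z assume "z \<in> rel_contraction A O rel_tensor (rel_bang r) (rel_bang r)"
    then obtain \<sigma> \<tau> where *: "Poly_Mapping.keys \<sigma> \<subseteq> r" "Poly_Mapping.keys \<tau> \<subseteq> r"
      "z = (fn (push fst (\<sigma> + \<tau>)), Tup (fn (push snd \<sigma>)) (fn (push snd \<tau>)))"
      by (auto simp: rel_bang_push rel_contraction_def rel_tensor_def push_add)
    have "(fn (push fst (\<sigma> + \<tau>)), fn (push snd (\<sigma> + \<tau>))) \<in> rel_bang r"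
      using *(1,2) by (intro rel_bangI) (simp add: keys_add_resource)
    moreover have "(fn (push snd (\<sigma> + \<tau>)), Tup (fn (push snd \<sigma>)) (fn (push snd \<tau>)))
        \<in> rel_contraction B"
      using keys(2)[OF *(1)] keys(2)[OF *(2)] by (auto simp: rel_contraction_def push_add)
    ultimately show "z \<in> rel_bang r O rel_contraction B"
      by (auto simp: *(3))
  qed
qed

text \<open>By \<open>push_eq_single_1D\<close>, a weight whose target marginal is a Dirac mass is a
  Dirac mass at a single pair of \<open>r\<close>.\<close>

lemma rel_dereliction_natural:
  fixes r :: "('x, 's::resource_semiring) relation"
  assumes "r \<subseteq> A \<times> B"
  shows "rel_bang r O rel_dereliction B = rel_dereliction A O r"
proof
  show "rel_bang r O rel_dereliction B \<subseteq> rel_dereliction A O r"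
  proof
    fix z assume "z \<in> rel_bang r O rel_dereliction B"
    then obtain \<sigma> b where *: "Poly_Mapping.keys \<sigma> \<subseteq> r" "push snd \<sigma> = Poly_Mapping.single b 1"
      "z = (fn (push fst \<sigma>), b)"
      by (auto simp: rel_bang_push rel_dereliction_def)
    from *(2) obtain p where "snd p = b" "\<sigma> = Poly_Mapping.single p 1"
      by (rule push_eq_single_1D)
    then show "z \<in> rel_dereliction A O r"
      using *(1) assms by (cases p) (auto simp: *(3) rel_dereliction_def)
  qed
  show "rel_dereliction A O r \<subseteq> rel_bang r O rel_dereliction B"
  proof
    fix z assume "z \<in> rel_dereliction A O r"
    then obtain a b where *: "(a, b) \<in> r" "z = (fn (Poly_Mapping.single a 1), b)"
      by (auto simp: rel_dereliction_def)
    have "(fn (Poly_Mapping.single a 1), fn (Poly_Mapping.single b 1)) \<in> rel_bang r"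
      using rel_bangI[of "Poly_Mapping.single (a, b) 1" r] *(1) by simp
    then show "z \<in> rel_bang r O rel_dereliction B"
      using *(1) assms by (auto simp: *(2) rel_dereliction_def)
  qed
qed


section \<open>The model\<close>

text \<open>\<open>dual\<close> is restated with the library converse in place of a set
  comprehension, so that the calculus of converses applies.\<close>

lemma rel_model_simps [simp]:
  "hom rel_model = (\<lambda>A B. Pow (A \<times> B))"
  "ident rel_model = Id_on"
  "compose rel_model = (\<lambda>s r. r O s)"
  "unit_ob rel_model = {Star}"
  "tensor_ob rel_model = rel_tensor_ob"
  "tensor rel_model = rel_tensor"
  "associator rel_model = rel_associator"
  "associator_inv rel_model = (\<lambda>A B C. (rel_associator A B C)\<inverse>)"
  "left_unitor rel_model = rel_left_unitor"
  "left_unitor_inv rel_model = (\<lambda>A. (rel_left_unitor A)\<inverse>)"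
  "right_unitor rel_model = rel_right_unitor"
  "right_unitor_inv rel_model = (\<lambda>A. (rel_right_unitor A)\<inverse>)"
  "symmetry rel_model = rel_symmetry"
  "dual_ob rel_model = (\<lambda>A. A)"
  "dual rel_model = (\<lambda>r. r\<inverse>)"
  "curry_dual rel_model = (\<lambda>A B C. rel_curry)"
  "zero_mor rel_model = (\<lambda>A B. {})"
  "add_mor rel_model = (\<union>)"
  "bang_ob rel_model = rel_bang_ob"
  "bang rel_model = rel_bang"
  "weakening rel_model = rel_weakening"
  "contraction rel_model = rel_contraction"
  "dereliction rel_model = rel_dereliction"
  by (simp_all add: rel_model_def converse_unfold)

section \<open>The preadditive star-autonomous category of relations\<close>

lemma rel_category: "category rel_model"
  by unfold_locales (simp_all, auto)

lemmas rel_monoidal_defs = rel_tensor_ob_def rel_tensor_def rel_associator_def rel_left_unitor_def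
  rel_right_unitor_def rel_symmetry_def

lemma rel_symmetric_monoidal_category: "symmetric_monoidal_category rel_model"
  by (intro symmetric_monoidal_category.intro rel_category symmetric_monoidal_category_axioms.intro)
    (simp_all add: rel_monoidal_defs, (fastforce simp: relcomp_unfold)+)

text \<open>As duality fixes objects, currying merely rebrackets triples, and the witness brackets
  them back.\<close>

lemma rel_curry_bij:
  "bij_betw rel_curry (Pow (rel_tensor_ob A B \<times> C)) (Pow (A \<times> rel_tensor_ob B C))"
  by (rule bij_betw_byWitness[where f' = "\<lambda>r. {(Tup a b, c) | a b c. (a, Tup b c) \<in> r}"])
    (fastforce simp: rel_curry_def rel_tensor_ob_def)+

lemma rel_star_autonomous_category: "star_autonomous_category rel_model"
proof (intro star_autonomous_category.intro star_autonomous_category_axioms.intro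
    rel_symmetric_monoidal_category)
  fix A B :: "('a, 'b) rel_object"
  show "bij_betw (dual rel_model) (hom rel_model A B)
      (hom rel_model (dual_ob rel_model B) (dual_ob rel_model A))"
    by (rule bij_betw_byWitness[where f' = converse]) auto
next
  fix f g h k :: "('a, 'b) relation" and A A' B B' C C' :: "('a, 'b) rel_object"
  show "curry_dual rel_model A' B' C' (compose rel_model (compose rel_model (dual rel_model h) k)
        (tensor rel_model f g)) =
      compose rel_model (compose rel_model (dual rel_model (tensor rel_model g h))
        (curry_dual rel_model A B C k)) f"
    by (fastforce simp: rel_curry_def rel_tensor_def)
qed (simp_all add: converse_relcomp rel_curry_bij)

lemma rel_preadditive_star_autonomous_category: "preadditive_star_autonomous_category rel_model"
  by (intro preadditive_star_autonomous_category.intro rel_star_autonomous_category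
      preadditive_star_autonomous_category_axioms.intro)
    (auto simp: rel_curry_def rel_tensor_def rel_tensor_ob_def)

text \<open>Elementwise form of the composite of associators and a symmetry that occurs in the
  bialgebra law.\<close>

lemma rel_exchange:
  "exchange rel_model A B C D =
    {(Tup (Tup a b) (Tup c d), Tup (Tup a c) (Tup b d)) | a b c d. a \<in> A \<and> b \<in> B \<and> c \<in> C \<and> d \<in> D}"
  by (fastforce simp: exchange_def rel_monoidal_defs relcomp_unfold)

lemma converse_rel_tensor: "(rel_tensor r s)\<inverse> = rel_tensor (r\<inverse>) (s\<inverse>)"
  by (auto simp: rel_tensor_def)

section \<open>Comonoid and bialgebra laws\<close>

lemma rel_contraction_counit:
  "rel_contraction A O rel_tensor (rel_weakening A) (Id_on (rel_bang_ob A)) O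
    rel_left_unitor (rel_bang_ob A) = Id_on (rel_bang_ob (A :: ('x, 's::resource_semiring) rel_object))"
  by (fastforce simp: relcomp_unfold rel_contraction_def rel_monoidal_defs rel_weakening_def
      rel_bang_ob_def Id_on_iff)

text \<open>Both sides are the relation splitting a weight into three. By
  \<open>keys_add_resource\<close> an intermediate sum is supported in \<open>A\<close> exactly when
  its summands are.\<close>

lemma rel_contraction_coassoc:
  "rel_contraction A O rel_tensor (rel_contraction A) (Id_on (rel_bang_ob A)) O
    rel_associator (rel_bang_ob A) (rel_bang_ob A) (rel_bang_ob A) =
    rel_contraction A O rel_tensor (Id_on (rel_bang_ob A)) (rel_contraction A)"
  (is "?l = ?r") for A :: "('x, 's::resource_semiring) rel_object"
proof -
  have "?l = {(fn (f + g + h), Tup (fn f) (Tup (fn g) (fn h))) | f g h.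
      Poly_Mapping.keys f \<subseteq> A \<and> Poly_Mapping.keys g \<subseteq> A \<and> Poly_Mapping.keys h \<subseteq> A}"
    by (fastforce simp: relcomp_unfold rel_contraction_def rel_monoidal_defs rel_bang_ob_def
        keys_add_resource Id_on_iff)
  also have "\<dots> = ?r"
    by (fastforce simp: relcomp_unfold rel_contraction_def rel_monoidal_defs rel_bang_ob_def
        keys_add_resource Id_on_iff add.assoc)
  finally show ?thesis .
qed

lemma rel_contraction_cocomm:
  "rel_contraction A O rel_symmetry (rel_bang_ob A) (rel_bang_ob A) = rel_contraction A"
  by (fastforce simp: relcomp_unfold rel_contraction_def rel_monoidal_defs rel_bang_ob_def add.commute)

text \<open>By positivity the zero weight has only the trivial splitting.\<close>

lemma rel_coweakening_contraction:
  fixes A :: "('x, 's::resource_semiring) rel_object"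
  shows "(rel_weakening A)\<inverse> O rel_contraction A =
    (rel_left_unitor {Star})\<inverse> O rel_tensor ((rel_weakening A)\<inverse>) ((rel_weakening A)\<inverse>)"
proof -
  have "0 = f + g \<longleftrightarrow> f = 0 \<and> g = 0" for f g :: "('x, 's) elt \<Rightarrow>\<^sub>0 's"
    using poly_mapping_add_eq_0_iff[of f g] by metis
  then show ?thesis
    by (fastforce simp: relcomp_unfold rel_contraction_def rel_monoidal_defs rel_weakening_def)
qed

text \<open>The left side says that two pairs of weights have the same sum; the right side asks for
  a two-by-two matrix of weights with these pairs as row and column sums. Additive splitting for
  weights supplies the matrix.\<close>

lemma rel_cocontraction_contraction:
  fixes A :: "('x, 's::resource_semiring) rel_object"
  defines "E \<equiv> exchange rel_model (rel_bang_ob A) (rel_bang_ob A) (rel_bang_ob A) (rel_bang_ob A)"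
  shows "(rel_contraction A)\<inverse> O rel_contraction A =
    rel_tensor (rel_contraction A) (rel_contraction A) O E O
      rel_tensor ((rel_contraction A)\<inverse>) ((rel_contraction A)\<inverse>)" (is "?l = ?r")
proof
  let ?k = Poly_Mapping.keys
  show "?l \<subseteq> ?r"
  proof
    fix z assume "z \<in> ?l"
    then obtain f1 f2 g1 g2 where z: "z = (Tup (fn f1) (fn f2), Tup (fn g1) (fn g2))"
      "f1 + f2 = g1 + g2" "?k f1 \<subseteq> A" "?k f2 \<subseteq> A"
      by (auto simp: rel_contraction_def)
    obtain h11 h12 h21 h22 where h: "f1 = h11 + h12" "f2 = h21 + h22" "g1 = h11 + h21" "g2 = h12 + h22"
      using z(2) by (rule poly_mapping_additive_splitting)
    have k: "?k h11 \<subseteq> A" "?k h12 \<subseteq> A" "?k h21 \<subseteq> A" "?k h22 \<subseteq> A"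
      using z(3,4) by (auto simp: h keys_add_resource)
    have "(Tup (fn f1) (fn f2), Tup (Tup (fn h11) (fn h12)) (Tup (fn h21) (fn h22)))
        \<in> rel_tensor (rel_contraction A) (rel_contraction A)"
      using k by (auto simp: rel_tensor_def rel_contraction_def h)
    moreover have "(Tup (Tup (fn h11) (fn h12)) (Tup (fn h21) (fn h22)),
        Tup (Tup (fn h11) (fn h21)) (Tup (fn h12) (fn h22))) \<in> E"
      using k by (auto simp: E_def rel_exchange rel_bang_ob_def)
    moreover have "(Tup (Tup (fn h11) (fn h21)) (Tup (fn h12) (fn h22)), Tup (fn g1) (fn g2))
        \<in> rel_tensor ((rel_contraction A)\<inverse>) ((rel_contraction A)\<inverse>)"
      using k by (auto simp: rel_tensor_def rel_contraction_def h)
    ultimately show "z \<in> ?r" unfolding z(1) by blast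
  qed
  show "?r \<subseteq> ?l"
  proof
    fix z assume "z \<in> ?r"
    then obtain h11 h12 h21 h22 where z:
      "z = (Tup (fn (h11 + h12)) (fn (h21 + h22)), Tup (fn (h11 + h21)) (fn (h12 + h22)))"
      "?k h11 \<subseteq> A" "?k h12 \<subseteq> A" "?k h21 \<subseteq> A" "?k h22 \<subseteq> A"
      by (auto simp: E_def rel_exchange rel_tensor_def rel_contraction_def)
    have "(Tup (fn (h11 + h12)) (fn (h21 + h22)), fn (h11 + h12 + (h21 + h22))) \<in> (rel_contraction A)\<inverse>"
      using z(2-) by (auto simp: rel_contraction_def keys_add_resource)
    moreover have "(fn (h11 + h21 + (h12 + h22)), Tup (fn (h11 + h21)) (fn (h12 + h22))) \<in> rel_contraction A"
      using z(2-) by (auto simp: rel_contraction_def keys_add_resource)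
    ultimately show "z \<in> ?l"
      unfolding z(1) by (auto simp: add.assoc add.left_commute)
  qed
qed

section \<open>Dereliction against the co-structure\<close>

text \<open>A Dirac mass determines its point because 1 differs from 0.\<close>

lemma rel_codereliction_dereliction:
  fixes A :: "('x, 's::resource_semiring) rel_object"
  shows "(rel_dereliction A)\<inverse> O rel_dereliction A = Id_on A"
proof -
  have "Poly_Mapping.single a (1 :: 's) = Poly_Mapping.single b 1 \<longleftrightarrow> a = b" for a b :: "('x, 's) elt"
    by (metis lookup_single_eq lookup_single_not_eq zero_neq_one)
  then show ?thesis by (auto simp: rel_dereliction_def)
qed

lemma rel_coweakening_dereliction:
  fixes A :: "('x, 's::resource_semiring) rel_object"
  shows "(rel_weakening A)\<inverse> O rel_dereliction A = {}"
  by (auto simp: rel_dereliction_def rel_weakening_def)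
    (metis lookup_single_eq lookup_zero zero_neq_one)

text \<open>The two terms of the union are the two ways of splitting a Dirac mass given by
  \<open>single_1_eq_add_iff\<close>.\<close>

lemma rel_cocontraction_dereliction:
  fixes A :: "('x, 's::resource_semiring) rel_object"
  shows "(rel_contraction A)\<inverse> O rel_dereliction A =
    rel_tensor (rel_dereliction A) (rel_weakening A) O rel_right_unitor A \<union>
    rel_tensor (rel_weakening A) (rel_dereliction A) O rel_left_unitor A"
  by (fastforce simp: relcomp_unfold rel_contraction_def rel_monoidal_defs rel_weakening_def
      rel_dereliction_def single_1_eq_add_iff)

lemma rel_structure_map_subset:
  fixes A :: "('x, 's::resource_semiring) rel_object"
  shows "rel_weakening A \<subseteq> rel_bang_ob A \<times> {Star}"
    "rel_contraction A \<subseteq> rel_bang_ob A \<times> rel_tensor_ob (rel_bang_ob A) (rel_bang_ob A)"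
    "rel_dereliction A \<subseteq> rel_bang_ob A \<times> A"
  by (fastforce simp: rel_weakening_def rel_contraction_def rel_dereliction_def rel_bang_ob_def
      rel_tensor_ob_def keys_add_resource)+

section \<open>Laws obtained by taking converses\<close>

lemmas converse_rel_simps = converse_relcomp converse_rel_tensor converse_rel_bang converse_Un O_assoc

lemma rel_coweakening_natural:
  fixes r :: "('x, 's::resource_semiring) relation"
  shows "(rel_weakening A)\<inverse> O rel_bang r = (rel_weakening B)\<inverse>"
  \<comment> \<open>The schematic variables occur in the order \<open>r\<close>, \<open>B\<close>,
    \<open>A\<close>, so this is the law for \<open>r\<inverse>\<close> from \<open>B\<close> to
    \<open>A\<close>.\<close>
  using arg_cong[OF rel_weakening_natural[of "r\<inverse>" A B], of converse]
  by (simp add: converse_rel_simps)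

lemma rel_cocontraction_natural:
  fixes r :: "('x, 's::resource_semiring) relation"
  assumes "r \<subseteq> A \<times> B"
  shows "(rel_contraction A)\<inverse> O rel_bang r =
    rel_tensor (rel_bang r) (rel_bang r) O (rel_contraction B)\<inverse>"
proof -
  have "r\<inverse> \<subseteq> B \<times> A" using assms by auto
  from arg_cong[OF rel_contraction_natural[OF this], of converse] show ?thesis
    by (simp add: converse_rel_simps)
qed

lemma rel_codereliction_natural:
  fixes r :: "('x, 's::resource_semiring) relation"
  assumes "r \<subseteq> A \<times> B"
  shows "(rel_dereliction A)\<inverse> O rel_bang r = r O (rel_dereliction B)\<inverse>"
proof -
  have "r\<inverse> \<subseteq> B \<times> A" using assms by auto
  from arg_cong[OF rel_dereliction_natural[OF this], of converse] show ?thesis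
    by (simp add: converse_rel_simps)
qed

lemma rel_cocontraction_unit:
  fixes A :: "('x, 's::resource_semiring) rel_object"
  shows "(rel_left_unitor (rel_bang_ob A))\<inverse> O rel_tensor ((rel_weakening A)\<inverse>) (Id_on (rel_bang_ob A)) O
    (rel_contraction A)\<inverse> = Id_on (rel_bang_ob A)"
  using arg_cong[OF rel_contraction_counit[of A], of converse] by (simp add: converse_rel_simps)

text \<open>The converse of coassociativity has the inverse associator on the other side of the
  equation; it is moved across by invertibility of the associator.\<close>

lemma rel_cocontraction_assoc:
  fixes A :: "('x, 's::resource_semiring) rel_object"
  shows "rel_tensor ((rel_contraction A)\<inverse>) (Id_on (rel_bang_ob A)) O (rel_contraction A)\<inverse> =
    rel_associator (rel_bang_ob A) (rel_bang_ob A) (rel_bang_ob A) O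
      rel_tensor (Id_on (rel_bang_ob A)) ((rel_contraction A)\<inverse>) O (rel_contraction A)\<inverse>"
    (is "?l O ?c = ?a O ?r O ?c")
proof -
  let ?B = "rel_bang_ob A"
  have "?a O ?a\<inverse> = Id_on (rel_tensor_ob (rel_tensor_ob ?B ?B) ?B)"
    by (fastforce simp: rel_monoidal_defs)
  \<comment> \<open>The identity on the triple tensor is absorbed because the domain of
    \<open>?l\<close> lies in it, by the typing of contraction.\<close>
  moreover have "Id_on (rel_tensor_ob (rel_tensor_ob ?B ?B) ?B) O ?l = ?l"
    using rel_structure_map_subset(2)[of A] by (fastforce simp: rel_tensor_ob_def rel_tensor_def)
  ultimately have "(?a O ?a\<inverse>) O ?l = ?l" by (simp only:)
  then have "?l O ?c = ?a O (?a\<inverse> O ?l O ?c)" by (simp only: O_assoc[symmetric])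
  also have "?a\<inverse> O ?l O ?c = ?r O ?c"
    using arg_cong[OF rel_contraction_coassoc[of A], of converse] by (simp add: converse_rel_simps)
  finally show ?thesis .
qed

lemma rel_cocontraction_comm:
  fixes A :: "('x, 's::resource_semiring) rel_object"
  shows "rel_symmetry (rel_bang_ob A) (rel_bang_ob A) O (rel_contraction A)\<inverse> = (rel_contraction A)\<inverse>"
proof -
  have "(rel_symmetry B B)\<inverse> = rel_symmetry B B" for B :: "('x, 's) rel_object"
    by (auto simp: rel_symmetry_def)
  then show ?thesis
    using arg_cong[OF rel_contraction_cocomm[of A], of converse] by (simp add: converse_rel_simps)
qed

lemma rel_coweakening_weakening: "(rel_weakening A)\<inverse> O rel_weakening A = Id_on {Star}"
  by (auto simp: rel_weakening_def)

text \<open>Taking converses exchanges this bialgebra law with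
  \<open>rel_coweakening_contraction\<close>.\<close>

lemma rel_cocontraction_weakening:
  fixes A :: "('x, 's::resource_semiring) rel_object"
  shows "(rel_contraction A)\<inverse> O rel_weakening A =
    rel_tensor (rel_weakening A) (rel_weakening A) O rel_left_unitor {Star}"
  using arg_cong[OF rel_coweakening_contraction[of A], of converse] by (simp add: converse_rel_simps)

lemma rel_codereliction_weakening:
  fixes A :: "('x, 's::resource_semiring) rel_object"
  shows "(rel_dereliction A)\<inverse> O rel_weakening A = {}"
  using arg_cong[OF rel_coweakening_dereliction[of A], of converse] by (simp add: converse_rel_simps)

lemma rel_codereliction_contraction:
  fixes A :: "('x, 's::resource_semiring) rel_object"
  shows "(rel_dereliction A)\<inverse> O rel_contraction A =
    (rel_right_unitor A)\<inverse> O rel_tensor ((rel_dereliction A)\<inverse>) ((rel_weakening A)\<inverse>) \<union>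
    (rel_left_unitor A)\<inverse> O rel_tensor ((rel_weakening A)\<inverse>) ((rel_dereliction A)\<inverse>)"
  using arg_cong[OF rel_cocontraction_dereliction[of A], of converse] by (simp add: converse_rel_simps)

theorem theorem3p10:
  "dill0_model (rel_model :: ('x, 's::resource_semiring) rel_structure)
     (\<lambda>A. {(a, b). (b, a) \<in> dereliction rel_model A})
     (\<lambda>A. {(a, b). (b, a) \<in> weakening rel_model A})
     (\<lambda>A. {(a, b). (b, a) \<in> contraction rel_model A})"
proof -
  have subset_converse: "r \<subseteq> A \<times> B \<Longrightarrow> r\<inverse> \<subseteq> B \<times> A"
    for r :: "('x, 's) relation" and A B
    by auto
  \<comment> \<open>The axioms are checked with the co-structure written as converses, the form of
    the lemmas above; unfolding \<open>converse\<close> then gives the set comprehensions.\<close>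
  have "dill0_model (rel_model :: ('x, 's) rel_structure)
      (\<lambda>A. (rel_dereliction A)\<inverse>) (\<lambda>A. (rel_weakening A)\<inverse>) (\<lambda>A. (rel_contraction A)\<inverse>)"
    by (intro dill0_model.intro rel_preadditive_star_autonomous_category
        dill0_model_axioms.intro)
      (simp_all add: subset_converse rel_bang_subset rel_bang_Id_on rel_bang_relcomp
        rel_structure_map_subset
        rel_weakening_natural rel_contraction_natural rel_dereliction_natural
        rel_contraction_counit rel_contraction_coassoc rel_contraction_cocomm
        rel_coweakening_contraction rel_cocontraction_contraction
        rel_codereliction_dereliction rel_coweakening_dereliction
        rel_cocontraction_dereliction rel_coweakening_natural rel_cocontraction_natural
        rel_codereliction_natural rel_cocontraction_unit rel_cocontraction_assoc
        rel_cocontraction_comm rel_coweakening_weakening rel_cocontraction_weakening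
        rel_codereliction_weakening rel_codereliction_contraction)
  then show ?thesis by (simp add: converse_unfold)
qed

end
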